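(* $\liminf_{k \to \infty} \#I(k) \leq 1$; that is, there are infinitely many positive integers $k$ with $\#I(k)\le 1$.
   Context: For a prime $p$ and $c\in\mathbb{Z}^+$, let $I_{p,c}=\{p^c, p^c+1,\dots,p^c+p^{c-1}-1\}$. For a positive integer $k$, $\#I(k)$ denotes the number of pairs $(p,c)$ with $p$ prime, $c\in\mathbb{Z}^+$, and $k\in I_{p,c}$. *)

theory Defs
  imports "HOL-Computational_Algebra.Primes" "HOL-Library.Extended_Real"
begin

definition I :: "nat \<Rightarrow> nat \<Rightarrow> nat set" where
  "I p c = {p ^ c .. p ^ c + p ^ (c - 1) - 1}"

definition I_pairs :: "nat \<Rightarrow> (nat \<times> nat) set" where
  "I_pairs k = {(p, c). prime p \<and> c \<ge> 1 \<and> k \<in> I p c}"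

definition num_I :: "nat \<Rightarrow> nat" where
  "num_I k = card (I_pairs k)"

text \<open>The set counted by \<^const>\<open>num_I\<close> is always finite, so \<^const>\<open>card\<close> is a genuine count.\<close>

lemma finite_I_pairs: "finite (I_pairs k)"
proof (rule finite_subset)
  show "I_pairs k \<subseteq> {..k} \<times> {..k}"
  proof
    fix x assume "x \<in> I_pairs k"
    then obtain p c where x: "x = (p, c)" and p: "prime p" and c: "c \<ge> 1" and k: "p ^ c \<le> k"
      by (auto simp: I_pairs_def I_def)
    have p2: "p \<ge> 2" using p by (rule prime_ge_2_nat)
    have "p \<le> p ^ c" using p2 c by (intro self_le_power) auto
    moreover have "c < p ^ c" using p2 by (intro power_gt_expt) auto
    ultimately show "x \<in> {..k} \<times> {..k}" using k by (auto simp: x)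
  qed
qed auto

end

(* Idea: the logarithmic average of #I(k) is below 2.  The set I p c has 1/k-weight at most 1/p,
   and about M / log2 p exponents c satisfy p^c < 2^M, so the sum of #I(k)/k over k < 2^M is at most
   about M times the sum of 1/(p log2 p) over all primes, improved for p = 2, where the weight is
   about ln(3/2) < 1/2.  Primes below 32 are treated individually; since the primes between 2^j and
   2^(j+1) all divide a central binomial coefficient, there are at most 2^(j+1)/j of them, so they
   contribute at most 2M/j^2.  Altogether this is at most 1.33 M + 1, whereas #I(k) >= 2 for almost
   all k would force a sum of at least 2 M ln 2 - O(1), and 2 ln 2 >= 4/3. *)

theory Submission
  imports Defs "HOL-Analysis.Harmonic_Numbers"
begin

section \<open>Logarithmic weight of the intervals\<close>

definition weight :: "nat \<Rightarrow> nat \<Rightarrow> real" where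
  "weight p c = (\<Sum>k\<in>I p c. 1 / real k)"

text \<open>Since \<open>p ^ c\<close> is the least element of \<open>I p c\<close>, for p > 0 these
  are the exponents whose interval meets \<open>{1..<2 ^ M}\<close>.\<close>

definition exps_below :: "nat \<Rightarrow> nat \<Rightarrow> nat set" where
  "exps_below p M = {c. 1 \<le> c \<and> p ^ c < 2 ^ M}"

definition prime_weight :: "nat \<Rightarrow> nat \<Rightarrow> real" where
  "prime_weight p M = (\<Sum>c\<in>exps_below p M. weight p c)"

lemma sum_inverse_block_le:
  assumes "n > 0"
  shows "(\<Sum>k\<in>{n * q..<(n + 1) * q}. 1 / real k) \<le> 1 / real n"
proof (cases "q = 0")
  case False
  then have pos: "n * q > 0"
    using assms by simp
  have "1 / real k \<le> 1 / real (n * q)" if "k \<in> {n * q..<(n + 1) * q}" for k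
    using that pos order.strict_trans2[OF pos, of k] by (intro divide_left_mono) (simp_all flip: of_nat_mult)
  then have "(\<Sum>k\<in>{n * q..<(n + 1) * q}. 1 / real k) \<le> real (card {n * q..<(n + 1) * q}) * (1 / real (n * q))"
    by (rule sum_bounded_above)
  also have "\<dots> = 1 / real n"
    using False by simp
  finally show ?thesis .
qed simp

lemma I_eq:
  assumes "p > 0" "c \<ge> 1"
  shows "I p c = {p * p ^ (c - 1)..<(p + 1) * p ^ (c - 1)}"
proof -
  define q where "q = p ^ (c - 1)"
  have "p ^ c = p * q" "q > 0"
    using assms by (cases c; simp add: q_def)+
  then show ?thesis
    unfolding I_def q_def[symmetric] by auto
qed

lemma weight_le:
  assumes "p > 0" "c \<ge> 1"
  shows "weight p c \<le> 1 / real p"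
  unfolding weight_def I_eq[OF assms] using assms by (intro sum_inverse_block_le) auto

text \<open>Cutting \<open>I 2 c\<close> into four blocks that start at 8q, 9q, 10q, 11q gives about
  0.427, close to ln(3/2). The plain bound 1/2 would push the final total above 2 ln 2.\<close>

lemma weight_two_le:
  assumes "c \<ge> 3"
  shows "weight 2 c \<le> 1/8 + 1/9 + 1/10 + 1/11"
proof -
  define q where "q = (2::nat) ^ (c - 3)"
  have "(2::nat) ^ (c - 1) = 4 * q"
    using assms by (auto simp: q_def le_iff_add power_add)
  then have "weight 2 c = (\<Sum>k\<in>{8 * q..<12 * q}. 1 / real k)"
    using assms by (simp add: weight_def I_eq)
  also have "\<dots> = (\<Sum>k\<in>{8 * q..<9 * q}. 1 / real k) + (\<Sum>k\<in>{9 * q..<10 * q}. 1 / real k)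
      + (\<Sum>k\<in>{10 * q..<11 * q}. 1 / real k) + (\<Sum>k\<in>{11 * q..<12 * q}. 1 / real k)"
    by (simp add: sum.atLeastLessThan_concat)
  finally show ?thesis
    using sum_inverse_block_le[of 8 q] sum_inverse_block_le[of 9 q]
      sum_inverse_block_le[of 10 q] sum_inverse_block_le[of 11 q] by simp
qed

section \<open>Number of exponents and total weight of one prime\<close>

text \<open>The fraction a/b is a rational upper bound of 1 / log2 p, and
  \<open>p ^ c < 2 ^ M\<close> means c < M / log2 p.\<close>

lemma exps_below_subset:
  assumes "b > 0" "2 ^ b \<le> p ^ a"
  shows "exps_below p M \<subseteq> {1..M * a div b}"
proof
  fix c assume "c \<in> exps_below p M"
  then have c: "c \<ge> 1" "p ^ c < 2 ^ M" by (auto simp: exps_below_def)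
  have "a > 0"
    using assms one_less_power[of "2::nat" b] by (intro gr0I) auto
  have "(2::nat) ^ (b * c) \<le> (p ^ a) ^ c"
    using assms by (simp add: power_mult power_mono)
  also have "\<dots> = (p ^ c) ^ a"
    by (simp flip: power_mult add: mult.commute)
  also have "\<dots> < (2 ^ M) ^ a"
    using c \<open>a > 0\<close> by (intro power_strict_mono) auto
  finally have "b * c < M * a"
    by (simp flip: power_mult)
  then show "c \<in> {1..M * a div b}"
    using c assms by (auto simp: less_eq_div_iff_mult_less_eq mult.commute)
qed

lemma finite_exps_below: "p \<ge> 2 \<Longrightarrow> finite (exps_below p M)"
  by (rule finite_subset[OF exps_below_subset[of 1 p 1]]) auto

text \<open>At most M a / b exponents occur, each of weight at most 1/p. The parameter
  \<open>x\<close> lets all primes of a dyadic range share one bound.\<close>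

lemma prime_weight_le:
  assumes "b > 0" "2 ^ b \<le> p ^ a" "p > 0" "1 / real p \<le> x"
  shows "prime_weight p M \<le> real M * (real a / real b * x)"
proof -
  have "prime_weight p M \<le> real (card (exps_below p M)) * (1 / real p)"
    unfolding prime_weight_def using assms
    by (intro sum_bounded_above weight_le) (auto simp: exps_below_def)
  also have "\<dots> \<le> (real M * real a / real b) * x"
  proof (rule mult_mono)
    have "card (exps_below p M) \<le> M * a div b"
      using card_mono[OF _ exps_below_subset[OF assms(1,2), of M]] by simp
    then have "real (card (exps_below p M)) \<le> real (M * a div b)"
      by simp
    also have "\<dots> \<le> real (M * a) / real b"
      by (rule of_nat_div_le_of_nat)
    finally show "real (card (exps_below p M)) \<le> real M * real a / real b"
      by simp
  qed (use assms in auto)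
  finally show ?thesis by (simp add: mult.assoc)
qed

lemma prime_weight_two_le:
  "prime_weight 2 M \<le> 1 + real M * (1/8 + 1/9 + 1/10 + 1/11)"
proof -
  let ?s = "1/8 + 1/9 + 1/10 + 1/11 :: real"
  have "prime_weight 2 M = (\<Sum>c\<in>{1..<M}. weight 2 c)"
    unfolding prime_weight_def by (intro sum.cong) (auto simp: exps_below_def)
  \<comment> \<open>The four-block bound starts at c = 3. The exponents 1 and 2 get an extra 1/2
    each, which yields the additive constant 1.\<close>
  also have "\<dots> \<le> (\<Sum>c\<in>{1..<M}. ?s + (if c < 3 then 1/2 else 0))"
    using weight_two_le weight_le[of 2] by (intro sum_mono) (fastforce simp: not_less)
  also have "\<dots> = real (card {1..<M}) * ?s + (\<Sum>c\<in>{1..<M}. if c < 3 then 1/2 else 0)"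
    by (simp add: sum.distrib)
  also have "(\<Sum>c\<in>{1..<M}. if c < 3 then 1/2 else 0 :: real) = (\<Sum>c\<in>{1..<M} \<inter> {c. c < 3}. 1/2)"
    by (simp add: sum.inter_restrict del: sum_constant)
  also have "\<dots> \<le> (\<Sum>c\<in>{1, 2::nat}. 1/2)"
    by (intro sum_mono2) auto
  also have "real (card {1..<M}) * ?s \<le> real M * ?s"
    by (intro mult_right_mono) auto
  finally show ?thesis by simp
qed

section \<open>Primes in dyadic ranges, by a Chebyshev-type estimate\<close>

lemma prod_primes_dvd:
  fixes m :: nat
  assumes "finite A" "\<And>p. p \<in> A \<Longrightarrow> prime p \<and> p dvd m"
  shows "\<Prod>A dvd m"
  using assms
proof (induction A)
  case (insert p A)
  have "coprime p (\<Prod>A)"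
    using insert by (intro prod_coprime_right) (auto intro: primes_coprime)
  then show ?case
    using insert by (simp add: divides_mult)
qed simp

text \<open>With n = 2^j, a prime in (n, 2n] divides (2n)! but not n!, hence divides
  \<open>2 * n choose n\<close>. The product of these primes is thus at most 2^(2n), while each
  factor is at least 2^j; comparing exponents gives the bound.\<close>

lemma card_primes_dyadic_le:
  assumes "j \<ge> 2"
  shows "j * card {p::nat. prime p \<and> 2 ^ j \<le> p \<and> p < 2 ^ Suc j} \<le> 2 ^ Suc j"
proof -
  define n where "n = (2::nat) ^ j"
  let ?D = "{p::nat. prime p \<and> 2 ^ j \<le> p \<and> p < 2 ^ Suc j}"
  have fin: "finite ?D"
    by (rule finite_subset[of _ "{..<2 ^ Suc j}"]) auto
  have "p dvd (2 * n choose n)" if p: "p \<in> ?D" for p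
  proof -
    \<comment> \<open>The left endpoint 2^j must be excluded, as it would divide n!. For j \<ge> 2
      it is even, whereas p \<ge> 4 is odd.\<close>
    have "(2::nat) ^ 2 \<le> 2 ^ j"
      using assms by (intro power_increasing) auto
    with p have "odd p"
      by (intro prime_odd_nat) auto
    then have "p \<noteq> 2 ^ j"
      using assms by auto
    then have "n < p" "p \<le> 2 * n" "prime p"
      using p by (auto simp: n_def)
    moreover have "fact n * fact n * (2 * n choose n) = (fact (2 * n) :: nat)"
      using binomial_fact_lemma[of n "2 * n"] by (simp add: mult_2)
    ultimately show ?thesis
      by (metis leD prime_dvd_fact_iff prime_dvd_mult_iff)
  qed
  then have dvd: "\<Prod>?D dvd (2 * n choose n)"
    using fin by (intro prod_primes_dvd) auto
  have "(2 ^ j) ^ card ?D = (\<Prod>p\<in>?D. 2 ^ j :: nat)"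
    by simp
  also have "\<dots> \<le> \<Prod>?D"
    by (intro prod_mono) auto
  also have "\<dots> \<le> (2 * n choose n)"
    using dvd by (intro dvd_imp_le) auto
  also have "\<dots> \<le> 2 ^ (2 * n)"
    by (rule binomial_le_pow2)
  finally have "(2::nat) ^ (j * card ?D) \<le> 2 ^ (2 * n)"
    by (simp add: power_mult)
  then show ?thesis
    by (simp add: n_def)
qed

lemma sum_prime_weight_dyadic_le:
  assumes "j \<ge> 2"
  shows "(\<Sum>p | prime p \<and> 2 ^ j \<le> p \<and> p < 2 ^ Suc j. prime_weight p M) \<le> real M * (2 / real j ^ 2)"
proof -
  let ?D = "{p::nat. prime p \<and> 2 ^ j \<le> p \<and> p < 2 ^ Suc j}"
  \<comment> \<open>Here a = 1 and b = j, because log2 p \<ge> j throughout the range.\<close>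
  have "prime_weight p M \<le> real M * (real 1 / real j * (1 / 2 ^ j))" if "p \<in> ?D" for p
  proof (rule prime_weight_le)
    have "(2::real) ^ j \<le> real p"
      using that of_nat_mono[of "2 ^ j" p, where ?'a = real] by simp
    then show "1 / real p \<le> 1 / 2 ^ j"
      by (intro divide_left_mono) (use that prime_gt_0_nat in auto)
  qed (use that assms prime_gt_0_nat in auto)
  then have "(\<Sum>p\<in>?D. prime_weight p M) \<le> real (card ?D) * (real M * (1 / (real j * 2 ^ j)))"
    by (intro sum_bounded_above) auto
  also have "\<dots> = real (j * card ?D) * (real M / (real j ^ 2 * 2 ^ j))"
    using assms by (simp add: field_simps power2_eq_square)
  also have "\<dots> \<le> real (2 ^ Suc j) * (real M / (real j ^ 2 * 2 ^ j))"
    by (intro mult_right_mono of_nat_mono card_primes_dyadic_le assms) auto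
  also have "\<dots> = real M * (2 / real j ^ 2)"
    by (simp add: field_simps)
  finally show ?thesis .
qed

text \<open>Telescoping from 1/j^2 \<le> 1/(j^2 - 1/4) = 1/(j - 1/2) - 1/(j + 1/2). From j = 5 on
  this gives 4/9; comparison with 1/(j(j - 1)) would give 1/2, too much for the final
  margin.\<close>

lemma sum_inverse_squares_le:
  assumes "a \<ge> 1" "a \<le> n"
  shows "(\<Sum>j=a..<n. 2 / real j ^ 2) \<le> 4 / (2 * real a - 1) - 4 / (2 * real n - 1)"
  using assms(2)
proof (induction n rule: dec_induct)
  case (step n)
  have "2 / real n ^ 2 \<le> 4 / (2 * real n - 1) - 4 / (2 * real n + 1)"
  proof -
    have n: "real n \<ge> 1" using assms step by simp
    then have sq: "real n ^ 2 \<ge> 1" by (rule one_le_power)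
    have "4 / (2 * real n - 1) - 4 / (2 * real n + 1) = 8 / (4 * real n ^ 2 - 1)"
      using diff_frac_eq[of "2 * real n - 1" "2 * real n + 1" 4 4] n
      by (simp add: algebra_simps power2_eq_square)
    also have "\<dots> \<ge> 8 / (4 * real n ^ 2)"
      using sq by (intro frac_le) linarith+
    finally show ?thesis by simp
  qed
  then show ?case using step by (simp add: algebra_simps)
qed simp

lemma sum_large_prime_weight_le:
  assumes "M \<ge> 5"
  shows "(\<Sum>p | prime p \<and> 32 \<le> p \<and> p < 2 ^ M. prime_weight p M) \<le> real M * (4 / 9)"
proof -
  let ?D = "\<lambda>i j. {p::nat. prime p \<and> 2 ^ i \<le> p \<and> p < 2 ^ j}"
  \<comment> \<open>The range from 32 = 2^5 is split into dyadic ranges, by induction on its upper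
    end.\<close>
  have "(\<Sum>p\<in>?D 5 n. prime_weight p M) = (\<Sum>j=5..<n. \<Sum>p\<in>?D j (Suc j). prime_weight p M)"
    if "n \<ge> 5" for n
    using that
  proof (induction n rule: dec_induct)
    case (step n)
    have "(2::nat) ^ 5 \<le> 2 ^ n"
      using step by (intro power_increasing) auto
    then have "?D 5 (Suc n) = ?D 5 n \<union> ?D n (Suc n)"
      by auto
    moreover have "finite (?D i j)" for i j
      by (rule finite_subset[of _ "{..<2 ^ j}"]) auto
    ultimately have "(\<Sum>p\<in>?D 5 (Suc n). prime_weight p M)
        = (\<Sum>p\<in>?D 5 n. prime_weight p M) + (\<Sum>p\<in>?D n (Suc n). prime_weight p M)"
      by (simp only: , intro sum.union_disjoint) auto
    then show ?case using step by simp
  qed (auto intro: sum.neutral)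
  from this[OF assms] have "(\<Sum>p\<in>?D 5 M. prime_weight p M)
      = (\<Sum>j=5..<M. \<Sum>p\<in>?D j (Suc j). prime_weight p M)" .
  also have "\<dots> \<le> (\<Sum>j=5..<M. real M * (2 / real j ^ 2))"
    by (intro sum_mono sum_prime_weight_dyadic_le) auto
  also have "\<dots> = real M * (\<Sum>j=5..<M. 2 / real j ^ 2)"
    by (simp add: sum_distrib_left)
  also have "\<dots> \<le> real M * (4 / 9)"
  proof (rule mult_left_mono)
    have "(\<Sum>j=5..<M. 2 / real j ^ 2) \<le> 4 / 9 - 4 / (2 * real M - 1)"
      using sum_inverse_squares_le[of 5 M] assms by simp
    also have "\<dots> \<le> 4 / 9"
      using assms by simp
    finally show "(\<Sum>j=5..<M. 2 / real j ^ 2) \<le> 4 / 9" .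
  qed simp
  finally show ?thesis by simp
qed

section \<open>Primes below 32\<close>

lemma primes_below_32:
  "{p::nat. prime p \<and> p < 32} = {2, 3, 5, 7, 11, 13, 17, 19, 23, 29, 31}"
proof -
  have "{p::nat. prime p \<and> p < 32} = set (filter prime [0..<32])"
    by auto
  also have "filter prime [0..<32] = [2, 3, 5, 7, 11, 13, 17, 19, 23, 29, 31::nat]"
    by code_simp
  finally show ?thesis by simp
qed

lemma sum_small_prime_weight_le:
  "(\<Sum>p | prime p \<and> p < 32. prime_weight p M) \<le> 1 + real M * (8803 / 10000)"
proof -
  \<comment> \<open>The fractions 7/11, 4/9, ... are upper bounds of 1 / log2 p, coming from 2^11 \<le> 3^7, 2^9 \<le> 5^4, ...\<close>
  have bounds:
    "prime_weight 3 M \<le> real M * (real 7 / real 11 * (1 / 3))"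
    "prime_weight 5 M \<le> real M * (real 4 / real 9 * (1 / 5))"
    "prime_weight 7 M \<le> real M * (real 5 / real 14 * (1 / 7))"
    "prime_weight 11 M \<le> real M * (real 3 / real 10 * (1 / 11))"
    "prime_weight 13 M \<le> real M * (real 3 / real 11 * (1 / 13))"
    "prime_weight 17 M \<le> real M * (real 1 / real 4 * (1 / 17))"
    "prime_weight 19 M \<le> real M * (real 1 / real 4 * (1 / 19))"
    "prime_weight 23 M \<le> real M * (real 2 / real 9 * (1 / 23))"
    "prime_weight 29 M \<le> real M * (real 2 / real 9 * (1 / 29))"
    "prime_weight 31 M \<le> real M * (real 2 / real 9 * (1 / 31))"
    by (rule prime_weight_le; simp)+
  \<comment> \<open>The coefficients of M, including the one for p = 2, add up to about
    0.8797.\<close>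
  show ?thesis
    unfolding primes_below_32 using bounds prime_weight_two_le[of M] by simp
qed

section \<open>Double counting and the total weight\<close>

lemma weighted_sum_num_I:
  "(\<Sum>k\<in>{1..<2 ^ M}. real (num_I k) / real k) \<le> (\<Sum>p | prime p \<and> p < 2 ^ M. prime_weight p M)"
proof -
  let ?P = "{p::nat. prime p \<and> p < 2 ^ M}"
  let ?S = "SIGMA p:?P. exps_below p M"
  have finP: "finite ?P"
    by (rule finite_subset[of _ "{..<2 ^ M}"]) auto
  have finE: "\<forall>p\<in>?P. finite (exps_below p M)"
    by (auto intro: finite_exps_below prime_ge_2_nat)
  have finS: "finite ?S"
    using finP finE by auto
  have finI: "finite (I p c)" for p c
    by (simp add: I_def)
  have card: "real (num_I k) / real k = (\<Sum>x\<in>?S. if k \<in> I (fst x) (snd x) then 1 / real k else 0)"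
    if "k \<in> {1..<2 ^ M}" for k
  proof -
    \<comment> \<open>Every pair counted by k satisfies p \<le> p^c \<le> k < 2^M, so the index set
      \<open>?S\<close> can be chosen independently of k.\<close>
    have "I_pairs k = {x \<in> ?S. k \<in> I (fst x) (snd x)}"
    proof (intro set_eqI iffI)
      fix x assume "x \<in> I_pairs k"
      then obtain p c where x: "x = (p, c)" "prime p" "c \<ge> 1" "k \<in> I p c"
        by (auto simp: I_pairs_def)
      then have "p ^ c < 2 ^ M"
        using that by (auto simp: I_def)
      moreover have "p \<le> p ^ c"
        using x prime_ge_2_nat by (intro self_le_power) (auto simp: Suc_leI prime_gt_0_nat)
      ultimately show "x \<in> {x \<in> ?S. k \<in> I (fst x) (snd x)}"
        using x by (auto simp: exps_below_def)
    qed (auto simp: I_pairs_def exps_below_def)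
    then show ?thesis
      using finS by (simp add: num_I_def sum.If_cases Int_def)
  qed
  have "(\<Sum>k\<in>{1..<2 ^ M}. real (num_I k) / real k)
      = (\<Sum>k\<in>{1..<2 ^ M}. \<Sum>x\<in>?S. if k \<in> I (fst x) (snd x) then 1 / real k else 0)"
    by (intro sum.cong card) auto
  also have "\<dots> = (\<Sum>x\<in>?S. \<Sum>k\<in>{1..<2 ^ M}. if k \<in> I (fst x) (snd x) then 1 / real k else 0)"
    by (rule sum.swap)
  \<comment> \<open>Only an inequality: an interval that starts below 2^M may extend beyond
    it.\<close>
  also have "\<dots> \<le> (\<Sum>x\<in>?S. weight (fst x) (snd x))"
    unfolding weight_def
    by (intro sum_mono, subst sum.inter_restrict[symmetric]) (auto intro!: sum_mono2 finI)
  also have "\<dots> = (\<Sum>p\<in>?P. prime_weight p M)"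
    unfolding prime_weight_def using finP finE by (subst sum.Sigma) (auto simp: case_prod_beta)
  finally show ?thesis .
qed

lemma weighted_sum_num_I_le:
  assumes "M \<ge> 5"
  shows "(\<Sum>k\<in>{1..<2 ^ M}. real (num_I k) / real k) \<le> 1 + real M * (133 / 100)"
proof -
  have "(2::nat) ^ 5 \<le> 2 ^ M"
    using assms by (intro power_increasing) auto
  then have split: "{p::nat. prime p \<and> p < 2 ^ M}
      = {p. prime p \<and> p < 32} \<union> {p. prime p \<and> 32 \<le> p \<and> p < 2 ^ M}"
    by auto
  have "(\<Sum>p | prime p \<and> p < 2 ^ M. prime_weight p M)
      = (\<Sum>p | prime p \<and> p < 32. prime_weight p M) + (\<Sum>p | prime p \<and> 32 \<le> p \<and> p < 2 ^ M. prime_weight p M)"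
    unfolding split by (rule sum.union_disjoint) auto
  also have "\<dots> \<le> (1 + real M * (8803 / 10000)) + real M * (4 / 9)"
    by (intro add_mono sum_small_prime_weight_le sum_large_prime_weight_le assms)
  \<comment> \<open>0.8803 + 4/9 is below 1.33.\<close>
  finally show ?thesis
    using weighted_sum_num_I[of M] by simp
qed

section \<open>Comparison with the harmonic sum\<close>

lemma sum_inverse_ge: "(\<Sum>k\<in>{1..<2 ^ M}. 1 / real k) \<ge> real M * (2 / 3)"
proof -
  have "real M * (2 / 3) \<le> real M * ln 2"
    by (intro mult_left_mono ln2_ge_two_thirds) auto
  also have "\<dots> = ln (real (2 ^ M - 1) + 1)"
    by (simp add: ln_realpow of_nat_diff)
  also have "\<dots> \<le> harm (2 ^ M - 1)"
    by (rule harm_ge_ln)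
  also have "\<dots> = (\<Sum>k\<in>{1..<2 ^ M}. 1 / real k)"
    unfolding harm_def by (intro sum.cong) (auto simp: inverse_eq_divide)
  finally show ?thesis .
qed

lemma infinite_num_I_le_1: "infinite {k::nat. k > 0 \<and> num_I k \<le> 1}"
proof
  assume "finite {k::nat. k > 0 \<and> num_I k \<le> 1}"
  then obtain K where K: "\<And>k. k > 0 \<Longrightarrow> num_I k \<le> 1 \<Longrightarrow> k < K"
    by (auto simp: finite_nat_set_iff_bounded)
  have le: "real M * (4 / 3) - 2 * real K \<le> 1 + real M * (133 / 100)" if "M \<ge> 5" for M
  proof -
    \<comment> \<open>From \<open>K\<close> on, \<open>num_I k\<close> is at least 2. Below
      \<open>K\<close>, subtracting 2 makes the left side nonpositive, at a total cost of at most
      2K.\<close>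
    have "2 / real k - (if k < K then 2 else 0) \<le> real (num_I k) / real k" if "k \<ge> 1" for k
    proof (cases "k < K")
      case True
      have "2 / real k \<le> 2"
        using that by (simp add: field_simps)
      moreover have "0 \<le> real (num_I k) / real k"
        by simp
      ultimately have "2 / real k - 2 \<le> real (num_I k) / real k" by linarith
      then show ?thesis using True by simp
    next
      case False
      then show ?thesis
        using K[of k] that by (force intro: divide_right_mono)
    qed
    then have "(\<Sum>k\<in>{1..<2 ^ M}. 2 / real k - (if k < K then 2 else 0))
        \<le> (\<Sum>k\<in>{1..<2 ^ M}. real (num_I k) / real k)"
      by (intro sum_mono) auto
    moreover have "(\<Sum>k\<in>{1..<2 ^ M}. if k < K then 2 else 0 :: real) \<le> (\<Sum>k<K. 2)"
      by (subst sum.inter_filter[symmetric]) (auto intro!: sum_mono2 simp del: sum_constant)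
    moreover have "(\<Sum>k\<in>{1..<2 ^ M}. 2 / real k) = 2 * (\<Sum>k\<in>{1..<2 ^ M}. 1 / real k)"
      by (simp add: sum_distrib_left)
    ultimately show ?thesis
      using weighted_sum_num_I_le[OF \<open>M \<ge> 5\<close>] sum_inverse_ge[of M] by (simp add: sum_subtractf)
  qed
  show False
    \<comment> \<open>The slopes differ by 4/3 - 133/100 = 1/300, so this M gives a surplus of 2K +
      2, exceeding the allowed 2K + 1.\<close>
    using le[of "600 * K + 600"] by (simp add: field_simps)
qed

theorem mainTheorem3:
  shows "liminf (\<lambda>k::nat. ereal (real (num_I k))) \<le> 1 \<and> infinite {k::nat. k > 0 \<and> num_I k \<le> 1}"
proof
  show "liminf (\<lambda>k::nat. ereal (real (num_I k))) \<le> 1"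
  proof (rule ccontr)
    assume "\<not> ?thesis"
    \<comment> \<open>A lower limit above 1 would leave only finitely many k with
      \<open>num_I k \<le> 1\<close>.\<close>
    then have "eventually (\<lambda>k. 1 < ereal (real (num_I k))) sequentially"
      by (intro less_LiminfD) simp
    then obtain N where "\<And>k. k \<ge> N \<Longrightarrow> num_I k > 1"
      by (auto simp: eventually_sequentially)
    then have "{k::nat. k > 0 \<and> num_I k \<le> 1} \<subseteq> {..<N}"
      by (metis (no_types, lifting) leD leI lessThan_iff mem_Collect_eq subsetI)
    then show False
      using infinite_num_I_le_1 finite_subset by blast
  qed
qed (rule infinite_num_I_le_1)

end
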